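(* The coverability problem is undecidable for branch-effective branch-WSTS $\mathcal{S}=(X,\Sigma,\to,\leq,x_0)$, even when $\mathcal{S}$ is strongly monotone and $\leq$ is a well-quasi-ordering.
   Context: An OLTS is $(X,\Sigma,\to,\leq,x_0)$ with state set $X$, finite alphabet $\Sigma$, transitions ${\to}\subseteq X\times\Sigma\times X$, quasi-ordering $\leq$, initial state $x_0$; $\mathrm{Post}(x)=\{y\mid x\to y\}$, $\mathrm{Post}^*(x)$ the set of states reachable from $x$, and $\downarrow Y=\{z\mid z\leq y\text{ for some }y\in Y\}$. It is a branch-WSTS if finitely branching (each $\mathrm{Post}(x)$ finite), branch-monotone (whenever $x\xrightarrow{\sigma}x'$, $\sigma\in\Sigma^*$, and $x\leq x'$, there is $y$ with $x'\xrightarrow{\sigma}y$ and $x'\leq y$) and branch-wqo (the states visited along every run from $x_0$ form a set well-quasi-ordered by $\leq$); branch-effective if $\leq$ and each $\xrightarrow{a}$ are decidable and each $\mathrm{Post}(x)$ is computable. Strongly monotone: for all $x,y,x'$ with $x\leq y$ and $x\to x'$ there is $y'$ with $y\to y'$ and $x'\leq y'$. The coverability problem: given the system and a state $y$, is $y$ coverable from $x_0$, i.e. $y\in\downarrow\mathrm{Post}^*(x_0)$? *)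

theory Defs
  imports Main "HOL-Library.Nat_Bijection"
begin

section \<open>Partial recursive functions\<close>

text \<open>Programs for the unary partial recursive functions; several arguments are passed through the
  Cantor pairing function \<^const>\<open>prod_encode\<close>. \<open>RecP\<close> is primitive recursion and \<open>MuP\<close> is
  unbounded minimisation.\<close>

datatype prog =
    ZeroP | SuccP | FstP | SndP
  | PairP prog prog
  | CompP prog prog
  | RecP prog prog
  | MuP prog

text \<open>\<open>runs p x v\<close>: program \<open>p\<close> halts on input \<open>x\<close> with output \<open>v\<close>.\<close>

inductive runs :: "prog \<Rightarrow> nat \<Rightarrow> nat \<Rightarrow> bool" where
  runs_Zero: "runs ZeroP x 0"
| runs_Succ: "runs SuccP x (Suc x)"
| runs_Fst: "runs FstP (prod_encode (x, y)) x"
| runs_Snd: "runs SndP (prod_encode (x, y)) y"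
| runs_Pair: "runs p x u \<Longrightarrow> runs q x v \<Longrightarrow> runs (PairP p q) x (prod_encode (u, v))"
| runs_Comp: "runs q x u \<Longrightarrow> runs p u v \<Longrightarrow> runs (CompP p q) x v"
| runs_Rec_0: "runs p x v \<Longrightarrow> runs (RecP p q) (prod_encode (x, 0)) v"
| runs_Rec_Suc: "runs (RecP p q) (prod_encode (x, n)) u \<Longrightarrow>
    runs q (prod_encode (x, prod_encode (n, u))) v \<Longrightarrow>
    runs (RecP p q) (prod_encode (x, Suc n)) v"
| runs_Mu: "runs p (prod_encode (x, n)) 0 \<Longrightarrow>
    (\<And>m. m < n \<Longrightarrow> \<exists>v. runs p (prod_encode (x, m)) (Suc v)) \<Longrightarrow>
    runs (MuP p) x n"

lemma runs_functional: "runs p x v \<Longrightarrow> runs p x w \<Longrightarrow> v = w"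
proof (induction arbitrary: w rule: runs.induct)
  case (runs_Zero x)
  then show ?case by (cases rule: runs.cases) auto
next
  case (runs_Succ x)
  then show ?case by (cases rule: runs.cases) auto
next
  case (runs_Fst x y)
  then show ?case by (cases rule: runs.cases) auto
next
  case (runs_Snd x y)
  then show ?case by (cases rule: runs.cases) auto
next
  case (runs_Pair p x u q v)
  from runs_Pair.prems show ?case
    by (cases rule: runs.cases) (auto dest: runs_Pair.IH)
next
  case (runs_Comp q x u p v)
  from runs_Comp.prems show ?case
    by (cases rule: runs.cases) (auto dest: runs_Comp.IH)
next
  case (runs_Rec_0 p x v q)
  from runs_Rec_0.prems show ?case
    by (cases rule: runs.cases) (auto dest: runs_Rec_0.IH)
next
  case (runs_Rec_Suc p q x n u v)
  from runs_Rec_Suc.prems show ?case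
    by (cases rule: runs.cases) (auto dest: runs_Rec_Suc.IH)
next
  case (runs_Mu p x n)
  from runs_Mu.prems show ?case
  proof (cases rule: runs.cases)
    case runs_Mu': runs_Mu
    show ?thesis
    proof (cases n w rule: linorder_cases)
      case less
      with runs_Mu' obtain u where "runs p (prod_encode (x, n)) (Suc u)" by auto
      then show ?thesis using runs_Mu.IH(1) by fastforce
    next
      case greater
      with runs_Mu.IH(2) runs_Mu' show ?thesis by fastforce
    qed
  qed
qed

definition decides :: "prog \<Rightarrow> nat set \<Rightarrow> bool" where
  "decides p A \<longleftrightarrow> (\<forall>n. runs p n (if n \<in> A then 1 else 0))"

text \<open>Goedel numbering of programs.\<close>

primrec prog_code :: "prog \<Rightarrow> nat" where
  "prog_code ZeroP = prod_encode (0, 0)"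
| "prog_code SuccP = prod_encode (1, 0)"
| "prog_code FstP = prod_encode (2, 0)"
| "prog_code SndP = prod_encode (3, 0)"
| "prog_code (PairP p q) = prod_encode (4, prod_encode (prog_code p, prog_code q))"
| "prog_code (CompP p q) = prod_encode (5, prod_encode (prog_code p, prog_code q))"
| "prog_code (RecP p q) = prod_encode (6, prod_encode (prog_code p, prog_code q))"
| "prog_code (MuP p) = prod_encode (7, prog_code p)"

lemma prog_code_inject: "prog_code p = prog_code q \<longleftrightarrow> p = q"
proof (induction p arbitrary: q)
  case ZeroP then show ?case by (cases q) auto
next
  case SuccP then show ?case by (cases q) auto
next
  case FstP then show ?case by (cases q) auto
next
  case SndP then show ?case by (cases q) auto
next
  case (PairP p1 p2) then show ?case by (cases q) auto
next
  case (CompP p1 p2) then show ?case by (cases q) auto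
next
  case (RecP p1 p2) then show ?case by (cases q) auto
next
  case (MuP p) then show ?case by (cases q) auto
qed

section \<open>Ordered labelled transition systems\<close>

record ('x, 'a) olts =
  states :: "'x set"
  alphabet :: "'a set"
  transitions :: "('x \<times> 'a \<times> 'x) set"
  leq :: "('x \<times> 'x) set"
  init_state :: 'x

definition is_olts :: "('x, 'a) olts \<Rightarrow> bool" where
  "is_olts S \<longleftrightarrow> finite (alphabet S) \<and>
     transitions S \<subseteq> states S \<times> alphabet S \<times> states S \<and>
     preorder_on (states S) (leq S) \<and>
     init_state S \<in> states S"

definition step_rel :: "('x, 'a) olts \<Rightarrow> ('x \<times> 'x) set" where
  "step_rel S = {(x, y). \<exists>a. (x, a, y) \<in> transitions S}"

fun word_step :: "('x, 'a) olts \<Rightarrow> 'x \<Rightarrow> 'a list \<Rightarrow> 'x \<Rightarrow> bool" where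
  "word_step S x [] y \<longleftrightarrow> x = y"
| "word_step S x (a # w) y \<longleftrightarrow> (\<exists>z. (x, a, z) \<in> transitions S \<and> word_step S z w y)"

definition post :: "('x, 'a) olts \<Rightarrow> 'x \<Rightarrow> 'x set" where
  "post S x = {y. (x, y) \<in> step_rel S}"

definition post_star :: "('x, 'a) olts \<Rightarrow> 'x \<Rightarrow> 'x set" where
  "post_star S x = {y. (x, y) \<in> (step_rel S)\<^sup>*}"

definition down_closure :: "('x, 'a) olts \<Rightarrow> 'x set \<Rightarrow> 'x set" where
  "down_closure S Y = {z. \<exists>y\<in>Y. (z, y) \<in> leq S}"

definition coverable :: "('x, 'a) olts \<Rightarrow> 'x \<Rightarrow> bool" where
  "coverable S y \<longleftrightarrow> y \<in> down_closure S (post_star S (init_state S))"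

definition wqo_on :: "'x set \<Rightarrow> ('x \<times> 'x) set \<Rightarrow> bool" where
  "wqo_on A r \<longleftrightarrow> preorder_on A (Restr r A) \<and>
     (\<forall>f :: nat \<Rightarrow> 'x. range f \<subseteq> A \<longrightarrow> (\<exists>i j. i < j \<and> (f i, f j) \<in> r))"

definition finitely_branching :: "('x, 'a) olts \<Rightarrow> bool" where
  "finitely_branching S \<longleftrightarrow> (\<forall>x\<in>states S. finite (post S x))"

text \<open>The last comparison is between \<open>x'\<close> and \<open>y\<close>: the run repeated from \<open>x'\<close> leads above \<open>x'\<close>.\<close>

definition branch_monotone :: "('x, 'a) olts \<Rightarrow> bool" where
  "branch_monotone S \<longleftrightarrow>
     (\<forall>x\<in>states S. \<forall>x'\<in>states S. \<forall>w\<in>lists (alphabet S).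
        word_step S x w x' \<and> (x, x') \<in> leq S \<longrightarrow>
        (\<exists>y. word_step S x' w y \<and> (x', y) \<in> leq S))"

definition finite_run :: "('x, 'a) olts \<Rightarrow> 'x list \<Rightarrow> bool" where
  "finite_run S xs \<longleftrightarrow> xs \<noteq> [] \<and> hd xs = init_state S \<and>
     successively (\<lambda>x y. (x, y) \<in> step_rel S) xs"

definition infinite_run :: "('x, 'a) olts \<Rightarrow> (nat \<Rightarrow> 'x) \<Rightarrow> bool" where
  "infinite_run S f \<longleftrightarrow> f 0 = init_state S \<and> (\<forall>i. (f i, f (Suc i)) \<in> step_rel S)"

definition branch_wqo :: "('x, 'a) olts \<Rightarrow> bool" where
  "branch_wqo S \<longleftrightarrow>
     (\<forall>xs. finite_run S xs \<longrightarrow> wqo_on (set xs) (leq S)) \<and>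
     (\<forall>f. infinite_run S f \<longrightarrow> wqo_on (range f) (leq S))"

definition branch_wsts :: "('x, 'a) olts \<Rightarrow> bool" where
  "branch_wsts S \<longleftrightarrow> is_olts S \<and> finitely_branching S \<and> branch_monotone S \<and> branch_wqo S"

definition strongly_monotone :: "('x, 'a) olts \<Rightarrow> bool" where
  "strongly_monotone S \<longleftrightarrow>
     (\<forall>x\<in>states S. \<forall>y\<in>states S. \<forall>x'\<in>states S.
        (x, y) \<in> leq S \<and> (x, x') \<in> step_rel S \<longrightarrow>
        (\<exists>y'. (y, y') \<in> step_rel S \<and> (x', y') \<in> leq S))"

section \<open>Effective presentations and the coverability problem\<close>

text \<open>Since algorithms act on finite descriptions, states and letters are natural numbers here. A
  system is given by a program for the quasi-ordering, a list pairing every letter \<open>a\<close> with a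
  program for the transition relation of \<open>a\<close>, a program for \<open>Post\<close>, and the initial state.\<close>

record presentation =
  leq_prog :: prog
  letter_progs :: "(nat \<times> prog) list"
  post_prog :: prog
  start :: nat

text \<open>No separate program for the state set is needed: \<open>x\<close> is a state iff \<open>x \<le> x\<close>. The program for
  \<open>Post\<close> is only constrained on states, and outputs some listing of the successors.\<close>

definition presents :: "presentation \<Rightarrow> (nat, nat) olts \<Rightarrow> bool" where
  "presents P S \<longleftrightarrow>
     decides (leq_prog P) (prod_encode ` leq S) \<and>
     fst ` set (letter_progs P) = alphabet S \<and>
     (\<forall>(a, p)\<in>set (letter_progs P).
        decides p {prod_encode (x, y) | x y. (x, a, y) \<in> transitions S}) \<and>
     (\<forall>x\<in>states S. \<exists>ys. set ys = post S x \<and> runs (post_prog P) x (list_encode ys)) \<and>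
     start P = init_state S"

definition branch_effective :: "(nat, nat) olts \<Rightarrow> bool" where
  "branch_effective S \<longleftrightarrow> (\<exists>P. presents P S)"

definition encode_instance :: "presentation \<Rightarrow> nat \<Rightarrow> nat" where
  "encode_instance P y = list_encode
     [prog_code (leq_prog P),
      list_encode (map (\<lambda>(a, p). prod_encode (a, prog_code p)) (letter_progs P)),
      prog_code (post_prog P),
      start P,
      y]"

text \<open>Decidability of coverability for the systems of a class \<open>C\<close>: a single algorithm receives a
  presentation of a system in \<open>C\<close> together with a state. Its behaviour on other inputs, including
  termination, is unconstrained.\<close>

definition coverability_decidable :: "(nat, nat) olts set \<Rightarrow> bool" where
  "coverability_decidable C \<longleftrightarrow>
     (\<exists>d. \<forall>S\<in>C. \<forall>P. presents P S \<longrightarrow>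
        (\<forall>y\<in>states S. runs d (encode_instance P y) (if coverable S y then 1 else 0)))"

text \<open>Instances are encoded injectively, and a presentation determines its system, so the problem is
  well posed.\<close>

lemma encode_instance_inject:
  "encode_instance P y = encode_instance Q z \<longleftrightarrow> P = Q \<and> y = z"
proof -
  have "inj (\<lambda>(a, p). prod_encode (a, prog_code p))"
    by (auto simp: inj_def prog_code_inject)
  then show ?thesis
    by (cases P; cases Q)
      (auto simp: encode_instance_def prog_code_inject list_encode_eq inj_map_eq_map
        simp del: list_encode.simps)
qed

lemma decides_unique: "decides p A \<Longrightarrow> decides p B \<Longrightarrow> A = B"
proof (rule set_eqI)
  fix n assume "decides p A" "decides p B"
  then have "(if n \<in> A then 1 else 0 :: nat) = (if n \<in> B then 1 else 0)"
    unfolding decides_def using runs_functional by blast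
  then show "n \<in> A \<longleftrightarrow> n \<in> B" by (simp split: if_splits)
qed

lemma presents_unique:
  assumes "presents P S" "presents P T" "is_olts S" "is_olts T"
  shows "S = T"
proof -
  have "decides (leq_prog P) (prod_encode ` leq S)" "decides (leq_prog P) (prod_encode ` leq T)"
    using assms(1,2) by (simp_all add: presents_def)
  then have "prod_encode ` leq S = prod_encode ` leq T"
    by (rule decides_unique)
  then have leq: "leq S = leq T"
    by (simp add: inj_image_eq_iff inj_prod_encode)
  have "states U = Field (leq U)" if "is_olts U" for U :: "(nat, nat) olts"
    using that by (auto simp: is_olts_def preorder_on_def refl_on_def Field_def)
  then have "states S = Field (leq S)" "states T = Field (leq T)"
    using assms(3,4) by simp_all
  with leq have st: "states S = states T" by simp
  have alph: "alphabet S = alphabet T" and ini: "init_state S = init_state T"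
    using assms(1,2) by (simp_all add: presents_def)
  have tr: "(x, a, y) \<in> transitions S \<longleftrightarrow> (x, a, y) \<in> transitions T" for x a y
  proof (cases "a \<in> alphabet S")
    case True
    then have "a \<in> fst ` set (letter_progs P)"
      using assms(1) by (simp add: presents_def)
    then obtain p where p: "(a, p) \<in> set (letter_progs P)"
      by auto
    have "decides p {prod_encode (x, y) | x y. (x, a, y) \<in> transitions S}"
      using assms(1) p by (auto simp: presents_def)
    moreover have "decides p {prod_encode (x, y) | x y. (x, a, y) \<in> transitions T}"
      using assms(2) p by (auto simp: presents_def)
    ultimately have "{prod_encode (x, y) | x y. (x, a, y) \<in> transitions S} =
          {prod_encode (x, y) | x y. (x, a, y) \<in> transitions T}"
      by (rule decides_unique)
    then have "prod_encode (x, y) \<in> {prod_encode (x, y) | x y. (x, a, y) \<in> transitions S} \<longleftrightarrow>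
               prod_encode (x, y) \<in> {prod_encode (x, y) | x y. (x, a, y) \<in> transitions T}"
      by simp
    then show ?thesis by simp
  next
    case False
    then show ?thesis using alph assms(3,4) by (auto simp: is_olts_def)
  qed
  then have "transitions S = transitions T" by auto
  with leq st alph ini show ?thesis by simp
qed

end

theory Submission
  imports Defs
begin

text \<open>Any system in which a counter \<open>1, 2, 3, \<dots>\<close> may be incremented at will, and may move to the
  dead state \<open>0\<close> from the value \<open>x\<close> provided \<open>h x\<close>, is strongly monotone for every monotone
  predicate \<open>h\<close>, when \<open>0\<close> is comparable only to itself. The state \<open>0\<close> is coverable iff \<open>h\<close> holds
  somewhere. Given an alleged decision procedure \<open>d\<close>, the recursion theorem yields a program for the
  predicate ``\<open>d\<close> answers within \<open>n\<close> steps that \<open>0\<close> is not coverable in the system given by this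
  very program'', which is monotone in \<open>n\<close>; on that system \<open>d\<close> is wrong.\<close>

section \<open>Total computable functions\<close>

definition computable :: "(nat \<Rightarrow> nat) \<Rightarrow> bool" where
  "computable f \<longleftrightarrow> (\<exists>p. \<forall>x. runs p x (f x))"

abbreviation pfst :: "nat \<Rightarrow> nat" where
  "pfst x \<equiv> fst (prod_decode x)"

abbreviation psnd :: "nat \<Rightarrow> nat" where
  "psnd x \<equiv> snd (prod_decode x)"

lemma prod_encode_exhaust: obtains x y where "z = prod_encode (x, y)"
  by (metis prod_decode_inverse surj_pair)

text \<open>There is no identity among the basic programs; re-pairing both projections is one, since
  the pairing is bijective.\<close>

abbreviation idP :: prog where
  "idP \<equiv> PairP FstP SndP"

primrec constP :: "nat \<Rightarrow> prog" where
  "constP 0 = ZeroP"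
| "constP (Suc n) = CompP SuccP (constP n)"

lemma runs_fst: "runs FstP x (pfst x)"
  using runs_Fst[of "pfst x" "psnd x"] by simp

lemma runs_snd: "runs SndP x (psnd x)"
  using runs_Snd[of "pfst x" "psnd x"] by simp

lemma runs_id: "runs idP x x"
  using runs_Pair[OF runs_fst runs_snd, of x] by simp

lemma runs_const: "runs (constP n) x n"
  by (induction n) (auto intro: runs.intros)

lemma runs_rec:
  assumes "\<And>x. runs p x (b x)"
    and "\<And>x i r. runs q (prod_encode (x, prod_encode (i, r))) (g x i r)"
  shows "runs (RecP p q) (prod_encode (x, k)) (rec_nat (b x) (g x) k)"
  by (induction k) (auto intro: assms runs_Rec_0 runs_Rec_Suc)

named_theorems computable_intros

lemma computable_id [computable_intros]: "computable (\<lambda>x. x)"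
  unfolding computable_def using runs_id by blast

lemma computable_const [computable_intros]: "computable (\<lambda>x. n)"
  unfolding computable_def using runs_const by blast

lemma computable_comp:
  assumes "computable f" "computable g"
  shows "computable (\<lambda>x. f (g x))"
  using assms unfolding computable_def by (meson runs_Comp)

lemma computable_Suc [computable_intros]:
  assumes "computable f"
  shows "computable (\<lambda>x. Suc (f x))"
  using assms unfolding computable_def by (meson runs_Comp runs_Succ)

lemma computable_pfst [computable_intros]:
  assumes "computable f"
  shows "computable (\<lambda>x. pfst (f x))"
  using assms unfolding computable_def by (meson runs_Comp runs_fst)

lemma computable_psnd [computable_intros]:
  assumes "computable f"
  shows "computable (\<lambda>x. psnd (f x))"
  using assms unfolding computable_def by (meson runs_Comp runs_snd)

lemma computable_pair [computable_intros]:
  assumes "computable f" "computable g"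
  shows "computable (\<lambda>x. prod_encode (f x, g x))"
  using assms unfolding computable_def by (meson runs_Pair)

lemma computable_rec:
  assumes "computable b"
    and "computable (\<lambda>z. g (pfst z) (pfst (psnd z)) (psnd (psnd z)))"
    and "computable k"
  shows "computable (\<lambda>x. rec_nat (b x) (g x) (k x))"
proof -
  obtain p where p: "\<And>x. runs p x (b x)"
    using assms(1) unfolding computable_def by blast
  obtain q where "\<And>z. runs q z (g (pfst z) (pfst (psnd z)) (psnd (psnd z)))"
    using assms(2) unfolding computable_def by blast
  then have q: "\<And>x i r. runs q (prod_encode (x, prod_encode (i, r))) (g x i r)"
    by (metis fst_conv snd_conv prod_encode_inverse)
  obtain s where "\<And>x. runs s x (k x)"
    using assms(3) unfolding computable_def by blast
  then have "runs (CompP (RecP p q) (PairP idP s)) x (rec_nat (b x) (g x) (k x))" for x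
    by (meson runs_Comp runs_Pair runs_id runs_rec[where g = g, OF p q])
  then show ?thesis
    unfolding computable_def by blast
qed

text \<open>Branching is a recursion of length \<open>f x\<close> whose step ignores both the
  counter and the previous value.\<close>

lemma computable_if_zero:
  assumes "computable f" "computable g" "computable h"
  shows "computable (\<lambda>x. if f x = 0 then g x else h x)"
proof -
  have "computable (\<lambda>x. rec_nat (g x) (\<lambda>_ _. h x) (f x))"
    by (intro computable_rec computable_comp[OF assms(3)] assms computable_intros)
  moreover have "rec_nat u (\<lambda>_ _. v) n = (if n = 0 then u else v)" for u v n :: nat
    by (cases n) auto
  ultimately show ?thesis by simp
qed

lemma computable_pred [computable_intros]:
  assumes "computable f"
  shows "computable (\<lambda>x. f x - 1)"
proof -
  have "computable (\<lambda>x. rec_nat 0 (\<lambda>i _. i) (f x))"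
    by (intro computable_rec assms computable_intros)
  moreover have "rec_nat 0 (\<lambda>i _. i) n = n - 1" for n :: nat
    by (cases n) auto
  ultimately show ?thesis by simp
qed

lemma computable_diff [computable_intros]:
  assumes "computable f" "computable g"
  shows "computable (\<lambda>x. f x - g x)"
proof -
  have "computable (\<lambda>x. rec_nat (f x) (\<lambda>_ r. r - 1) (g x))"
    by (intro computable_rec assms computable_intros)
  moreover have "rec_nat m (\<lambda>_ r. r - 1) n = m - n" for m n :: nat
    by (induction n) auto
  ultimately show ?thesis by simp
qed

definition computable_set :: "(nat \<Rightarrow> bool) \<Rightarrow> bool" where
  "computable_set P \<longleftrightarrow> computable (\<lambda>x. if P x then 1 else 0)"

lemma computable_if [computable_intros]:
  assumes "computable_set P" "computable f" "computable g"
  shows "computable (\<lambda>x. if P x then f x else g x)"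
  by (rule back_subst[of computable,
      OF computable_if_zero[OF assms(1)[unfolded computable_set_def] assms(3,2)]]) auto

lemma computable_set_le [computable_intros]:
  assumes "computable f" "computable g"
  shows "computable_set (\<lambda>x. f x \<le> g x)"
  using computable_if_zero[OF computable_diff[OF assms] computable_const computable_const]
  by (simp add: computable_set_def)

lemma computable_set_conj [computable_intros]:
  assumes "computable_set P" "computable_set Q"
  shows "computable_set (\<lambda>x. P x \<and> Q x)"
  unfolding computable_set_def
  by (rule back_subst[of computable,
      OF computable_if[OF assms(1) assms(2)[unfolded computable_set_def] computable_const[of 0]]]) auto

lemma computable_set_not [computable_intros]:
  assumes "computable_set P"
  shows "computable_set (\<lambda>x. \<not> P x)"
  unfolding computable_set_def
  by (rule back_subst[of computable,
      OF computable_if[OF assms computable_const[of 0] computable_const[of 1]]]) auto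

lemma computable_set_disj [computable_intros]:
  assumes "computable_set P" "computable_set Q"
  shows "computable_set (\<lambda>x. P x \<or> Q x)"
  using computable_set_not[OF computable_set_conj[OF assms[THEN computable_set_not]]] by simp

lemma computable_set_imp [computable_intros]:
  assumes "computable_set P" "computable_set Q"
  shows "computable_set (\<lambda>x. P x \<longrightarrow> Q x)"
  using computable_set_disj[OF computable_set_not[OF assms(1)] assms(2)]
  by simp

lemma computable_set_eq [computable_intros]:
  assumes "computable f" "computable g"
  shows "computable_set (\<lambda>x. f x = g x)"
  using computable_set_conj[OF computable_set_le[OF assms] computable_set_le[OF assms(2,1)]]
  by (simp add: order_eq_iff)

section \<open>Kleene's recursion theorem\<close>

lemma computable_prog_code_constP: "computable (\<lambda>n. prog_code (constP n))"
proof -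
  let ?g = "\<lambda>(_ :: nat) r. prod_encode (5, prod_encode (prog_code SuccP, r))"
  have "computable (\<lambda>x. rec_nat (prog_code ZeroP) ?g x)"
    by (intro computable_rec computable_intros)
  moreover have "rec_nat (prog_code ZeroP) ?g n = prog_code (constP n)" for n
    by (induction n) auto
  ultimately show ?thesis by simp
qed

text \<open>Kleene's diagonal argument: compose \<open>F\<close> with the map taking a code
  \<open>a\<close> to the code of its program specialised to \<open>a\<close> itself, and specialise
  the resulting program \<open>p\<close> to its own code.\<close>

theorem recursion_theorem:
  assumes "computable F"
  shows "\<exists>q. \<forall>n. runs q n (F (prod_encode (prog_code q, n)))"
proof -
  \<comment> \<open>If \<open>a\<close> codes a program \<open>p\<close>, then \<open>s a\<close>
    codes \<open>CompP p (PairP (constP a) idP)\<close>; \<open>5\<close> and \<open>4\<close> are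
    the tags of \<open>CompP\<close> and \<open>PairP\<close>.\<close>
  define s where "s a = prod_encode (5, prod_encode (a,
    prod_encode (4, prod_encode (prog_code (constP a), prog_code idP))))" for a
  have "computable s"
    unfolding s_def by (intro computable_prog_code_constP computable_intros)
  then have "computable (\<lambda>z. F (prod_encode (s (pfst z), psnd z)))"
    by (intro computable_comp[OF assms] computable_pair computable_comp[of s pfst]
        computable_pfst computable_psnd computable_id)
  then obtain p where p: "\<And>z. runs p z (F (prod_encode (s (pfst z), psnd z)))"
    unfolding computable_def by blast
  define q where "q = CompP p (PairP (constP (prog_code p)) idP)"
  have "prog_code q = s (prog_code p)"
    by (simp add: q_def s_def)
  moreover have "runs q n (F (prod_encode (s (prog_code p), n)))" for n
    using runs_Comp[OF runs_Pair[OF runs_const runs_id] p] unfolding q_def by force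
  ultimately show ?thesis by metis
qed

section \<open>Evaluation with bounded resources\<close>

text \<open>\<open>eval_upto p n x\<close> is \<open>Suc v\<close> if \<open>p\<close> halts on \<open>x\<close> with output \<open>v\<close> and all its minimisations end
  below \<open>n\<close>, and \<open>0\<close> otherwise. During a minimisation the recursion value \<open>0\<close> means that the search
  goes on, \<open>1\<close> that it has failed, and \<open>Suc (Suc i)\<close> that it has found \<open>i\<close>.\<close>

primrec eval_upto :: "prog \<Rightarrow> nat \<Rightarrow> nat \<Rightarrow> nat" where
  "eval_upto ZeroP n x = 1"
| "eval_upto SuccP n x = Suc (Suc x)"
| "eval_upto FstP n x = Suc (pfst x)"
| "eval_upto SndP n x = Suc (psnd x)"
| "eval_upto (PairP p q) n x =
    (if eval_upto p n x = 0 \<or> eval_upto q n x = 0 then 0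
     else Suc (prod_encode (eval_upto p n x - 1, eval_upto q n x - 1)))"
| "eval_upto (CompP p q) n x =
    (if eval_upto q n x = 0 then 0 else eval_upto p n (eval_upto q n x - 1))"
| "eval_upto (RecP p q) n x =
    rec_nat (eval_upto p n (pfst x))
      (\<lambda>i r. if r = 0 then 0 else eval_upto q n (prod_encode (pfst x, prod_encode (i, r - 1))))
      (psnd x)"
| "eval_upto (MuP p) n x =
    rec_nat 0
      (\<lambda>i r. if r \<noteq> 0 then r
        else if eval_upto p n (prod_encode (x, i)) = 0 then 1
        else if eval_upto p n (prod_encode (x, i)) = 1 then Suc (Suc i)
        else 0) n - 1"

text \<open>This and the next equivalences describe success in the shape of the rules of
  \<open>runs\<close>; they replace the defining equations in the inductions below.\<close>

lemma eval_upto_Pair_iff: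
  "eval_upto (PairP p q) n x = Suc v \<longleftrightarrow>
    (\<exists>u w. eval_upto p n x = Suc u \<and> eval_upto q n x = Suc w \<and> v = prod_encode (u, w))"
  by (cases "eval_upto p n x"; cases "eval_upto q n x") auto

lemma eval_upto_Comp_iff:
  "eval_upto (CompP p q) n x = Suc v \<longleftrightarrow>
    (\<exists>u. eval_upto q n x = Suc u \<and> eval_upto p n u = Suc v)"
  by (cases "eval_upto q n x") auto

lemma eval_upto_Rec_0: "eval_upto (RecP p q) n (prod_encode (x, 0)) = eval_upto p n x"
  by simp

lemma eval_upto_Rec_Suc_iff:
  "eval_upto (RecP p q) n (prod_encode (x, Suc k)) = Suc v \<longleftrightarrow>
    (\<exists>u. eval_upto (RecP p q) n (prod_encode (x, k)) = Suc u \<and>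
      eval_upto q n (prod_encode (x, prod_encode (k, u))) = Suc v)"
  by (cases "eval_upto (RecP p q) n (prod_encode (x, k))") (auto cong: if_cong)

text \<open>The search value stays \<open>0\<close> as long as the candidates are refuted, and is
  frozen from its first nonzero value on.\<close>

lemma eval_upto_Mu_iff:
  "eval_upto (MuP p) n x = Suc k \<longleftrightarrow>
    k < n \<and> eval_upto p n (prod_encode (x, k)) = Suc 0 \<and>
    (\<forall>j<k. \<exists>v. eval_upto p n (prod_encode (x, j)) = Suc (Suc v))"
proof -
  define e where "e j = eval_upto p n (prod_encode (x, j))" for j
  define s where "s = rec_nat 0
    (\<lambda>i r. if r \<noteq> 0 then r else if e i = 0 then 1 else if e i = 1 then Suc (Suc i) else 0)"
  have s_Suc: "s (Suc i) =
      (if s i \<noteq> 0 then s i else if e i = 0 then 1 else if e i = 1 then Suc (Suc i) else 0)" for i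
    by (simp add: s_def)
  have s0: "s i = 0 \<longleftrightarrow> (\<forall>j<i. \<exists>v. e j = Suc (Suc v))" for i
  proof (induction i)
    case (Suc i)
    have "(\<exists>v. e i = Suc (Suc v)) \<longleftrightarrow> e i \<noteq> 0 \<and> e i \<noteq> 1"
      by (metis One_nat_def nat.distinct(1) nat.inject not0_implies_Suc)
    with Suc show ?case by (auto simp: s_Suc less_Suc_eq)
  qed (simp add: s_def)
  have "s i = Suc (Suc k) \<longleftrightarrow>
      k < i \<and> e k = Suc 0 \<and> (\<forall>j<k. \<exists>v. e j = Suc (Suc v))" for i
  proof (induction i)
    case (Suc i)
    show ?case
    proof (cases "s i = 0")
      case True
      with s0[of i] show ?thesis by (auto simp: s_Suc less_Suc_eq)
    next
      case False
      with s0[of i] Suc show ?thesis by (auto simp: s_Suc less_Suc_eq)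
    qed
  qed (simp add: s_def)
  moreover have "eval_upto (MuP p) n x = s n - 1"
    by (simp add: s_def e_def cong: if_cong)
  \<comment> \<open>The final decrement merges an unfinished and a failed search into
    \<open>0\<close>.\<close>
  moreover have "s n - 1 = Suc k \<longleftrightarrow> s n = Suc (Suc k)"
    by arith
  ultimately show ?thesis
    by (simp only: e_def)
qed

lemmas eval_upto_iff =
  eval_upto_Pair_iff eval_upto_Comp_iff eval_upto_Rec_0 eval_upto_Rec_Suc_iff eval_upto_Mu_iff

declare eval_upto.simps(5-8) [simp del]

text \<open>The bound enters only through \<open>k < n\<close> in a minimisation, so raising it
  preserves every success.\<close>

lemma eval_upto_mono:
  "eval_upto p n x = Suc v \<Longrightarrow> n \<le> m \<Longrightarrow> eval_upto p m x = Suc v"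
proof (induction p arbitrary: x v)
  case (PairP p q)
  then show ?case by (auto simp: eval_upto_iff)
next
  case (CompP p q)
  then show ?case by (auto simp: eval_upto_iff)
next
  case (RecP p q)
  have "eval_upto (RecP p q) n (prod_encode (y, k)) = Suc u \<Longrightarrow>
      eval_upto (RecP p q) m (prod_encode (y, k)) = Suc u" for y k u
    by (induction k arbitrary: u) (auto simp: eval_upto_iff RecP.IH \<open>n \<le> m\<close>)
  with RecP.prems show ?case by (metis prod_encode_exhaust)
next
  case (MuP p)
  then show ?case unfolding eval_upto_iff by (meson order_less_le_trans)
qed simp_all

lemma eval_upto_sound: "eval_upto p n x = Suc v \<Longrightarrow> runs p x v"
proof (induction p arbitrary: x v)
  case (PairP p q)
  then show ?case by (auto simp: eval_upto_iff intro: runs_Pair)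
next
  case (CompP p q)
  then show ?case unfolding eval_upto_iff by (meson runs_Comp)
next
  case (RecP p q)
  have "eval_upto (RecP p q) n (prod_encode (y, k)) = Suc u \<Longrightarrow>
      runs (RecP p q) (prod_encode (y, k)) u" for y k u
    by (induction k arbitrary: u)
      (auto simp: eval_upto_iff intro: runs_Rec_0 runs_Rec_Suc RecP.IH)
  with RecP.prems show ?case by (metis prod_encode_exhaust)
next
  case (MuP p)
  then show ?case unfolding eval_upto_iff by (meson runs_Mu)
qed (auto intro: runs_Zero runs_Succ runs_fst runs_snd)

text \<open>A halting computation has finitely many subcomputations; by monotonicity the maximum of
  their bounds serves all of them.\<close>

lemma eval_upto_complete: "runs p x v \<Longrightarrow> \<exists>n. eval_upto p n x = Suc v"
proof (induction rule: runs.induct)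
  case (runs_Pair p x u q v)
  then obtain n m where "eval_upto p n x = Suc u" "eval_upto q m x = Suc v" by blast
  then have "eval_upto p (max n m) x = Suc u" "eval_upto q (max n m) x = Suc v"
    by (auto elim: eval_upto_mono)
  then have "eval_upto (PairP p q) (max n m) x = Suc (prod_encode (u, v))"
    by (simp add: eval_upto_iff)
  then show ?case by blast
next
  case (runs_Comp q x u p v)
  then obtain n m where "eval_upto q n x = Suc u" "eval_upto p m u = Suc v" by blast
  then have "eval_upto q (max n m) x = Suc u" "eval_upto p (max n m) u = Suc v"
    by (auto elim: eval_upto_mono)
  then have "eval_upto (CompP p q) (max n m) x = Suc v"
    by (simp add: eval_upto_iff)
  then show ?case by blast
next
  case (runs_Rec_Suc p q x k u v)
  then obtain n m where "eval_upto (RecP p q) n (prod_encode (x, k)) = Suc u"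
    "eval_upto q m (prod_encode (x, prod_encode (k, u))) = Suc v" by blast
  then have "eval_upto (RecP p q) (max n m) (prod_encode (x, k)) = Suc u"
    "eval_upto q (max n m) (prod_encode (x, prod_encode (k, u))) = Suc v"
    by (auto elim: eval_upto_mono)
  then have "eval_upto (RecP p q) (max n m) (prod_encode (x, Suc k)) = Suc v"
    by (simp add: eval_upto_iff)
  then show ?case by blast
next
  case (runs_Mu p x k)
  then obtain n where n: "eval_upto p n (prod_encode (x, k)) = Suc 0" by blast
  from runs_Mu.IH(2) obtain N v where
    N: "\<And>j. j < k \<Longrightarrow> eval_upto p (N j) (prod_encode (x, j)) = Suc (Suc (v j))" by metis
  \<comment> \<open>\<open>N j\<close> is a bound for the refuted candidate \<open>j\<close>,
    \<open>n\<close> one for \<open>k\<close> itself, and \<open>Suc k\<close> puts the result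
    \<open>k\<close> below \<open>M\<close>.\<close>
  define M where "M = Max (insert (Suc k) (insert n (N ` {..<k})))"
  have "k < M" "n \<le> M" "\<And>j. j < k \<Longrightarrow> N j \<le> M"
    unfolding M_def by (auto intro!: Max_ge simp flip: Suc_le_eq simp del: Max_insert)
  then have "eval_upto (MuP p) M x = Suc k"
    unfolding eval_upto_Mu_iff using n N by (meson eval_upto_mono)
  then show ?case by blast
qed (auto simp: eval_upto_Rec_0)

lemma computable_comp2:
  assumes "computable (\<lambda>z. F (pfst z) (psnd z))" "computable f" "computable g"
  shows "computable (\<lambda>x. F (f x) (g x))"
  using computable_comp[OF assms(1) computable_pair[OF assms(2,3)]] by simp

text \<open>Here \<open>p\<close> is fixed rather than an input, which suffices because only the
  alleged decision procedure gets simulated.\<close>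

lemma computable_eval_upto: "computable (\<lambda>z. eval_upto p (pfst z) (psnd z))"
proof (induction p)
  case (PairP p q)
  note IH = PairP[THEN computable_comp2]
  show ?case
    by (simp only: eval_upto.simps, intro IH computable_intros)
next
  case (CompP p q)
  note IH = CompP[THEN computable_comp2]
  show ?case
    by (simp only: eval_upto.simps, intro IH computable_intros)
next
  case (RecP p q)
  note IH = RecP[THEN computable_comp2]
  show ?case
    by (simp only: eval_upto.simps, intro IH computable_rec computable_intros)
next
  case (MuP p)
  note IH = MuP[THEN computable_comp2]
  show ?case
    by (simp only: eval_upto.simps, intro IH computable_rec computable_intros)
qed (simp_all, (intro computable_intros)+)

section \<open>Strongly monotone systems with one letter\<close>

text \<open>Words are simulated letter by letter. Strong monotonicity forgets labels, but with a
  single letter the matching step carries the same label.\<close>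

lemma word_step_mono:
  assumes "is_olts S" "strongly_monotone S" "alphabet S = {a}"
  shows "word_step S x w x' \<Longrightarrow> (x, z) \<in> leq S \<Longrightarrow> x \<in> states S \<Longrightarrow> z \<in> states S \<Longrightarrow>
    \<exists>y. word_step S z w y \<and> (x', y) \<in> leq S"
proof (induction w arbitrary: x z)
  case (Cons b w)
  then obtain u where u: "(x, b, u) \<in> transitions S" "word_step S u w x'" by auto
  have tr: "transitions S \<subseteq> states S \<times> {a} \<times> states S"
    using assms(1,3) by (simp add: is_olts_def)
  with u(1) have "b = a" "u \<in> states S" by auto
  with u(1) Cons.prems assms(2) obtain v where v: "(z, v) \<in> step_rel S" "(u, v) \<in> leq S"
    unfolding strongly_monotone_def by (metis (mono_tags, lifting) case_prodI mem_Collect_eq step_rel_def)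
  with tr \<open>b = a\<close> have "(z, b, v) \<in> transitions S" "v \<in> states S"
    by (auto simp: step_rel_def)
  with Cons.IH[OF u(2) v(2) \<open>u \<in> states S\<close>] show ?case by auto
qed simp

text \<open>Take \<open>z = x'\<close> in the simulation: the run from \<open>x\<close> to
  \<open>x'\<close> is repeated from \<open>x'\<close> and ends above \<open>x'\<close>.\<close>

lemma branch_monotone_single_letter:
  assumes "is_olts S" "strongly_monotone S" "alphabet S = {a}"
  shows "branch_monotone S"
  unfolding branch_monotone_def using word_step_mono[OF assms] by blast

lemma wqo_on_subset: "wqo_on A r \<Longrightarrow> B \<subseteq> A \<Longrightarrow> wqo_on B r"
  unfolding wqo_on_def preorder_on_def refl_on_def trans_def by (auto; blast)

lemma branch_wqo_UNIV: "wqo_on UNIV (leq S) \<Longrightarrow> branch_wqo S"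
  unfolding branch_wqo_def using wqo_on_subset by blast

lemma coverability_decidable_subset:
  "coverability_decidable C \<Longrightarrow> D \<subseteq> C \<Longrightarrow> coverability_decidable D"
  unfolding coverability_decidable_def by blast

section \<open>The counter with an exit\<close>

text \<open>Isolating \<open>0\<close> in the order turns covering \<open>0\<close> into reaching
  it, and the union of two such chains is still a well-quasi-ordering.\<close>

definition counter_exit :: "(nat \<Rightarrow> bool) \<Rightarrow> (nat, nat) olts" where
  "counter_exit h = \<lparr>
    states = UNIV,
    alphabet = {0},
    transitions = {(x, a, y). a = 0 \<and> x \<noteq> 0 \<and> (y = Suc x \<or> y = 0 \<and> h x)},
    leq = {(x, y). x \<le> y \<and> (x = 0 \<longrightarrow> y = 0)},
    init_state = 1\<rparr>"

lemma counter_exit_simps [simp]: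
  "states (counter_exit h) = UNIV"
  "alphabet (counter_exit h) = {0}"
  "(x, a, y) \<in> transitions (counter_exit h) \<longleftrightarrow>
    a = 0 \<and> x \<noteq> 0 \<and> (y = Suc x \<or> y = 0 \<and> h x)"
  "(x, y) \<in> leq (counter_exit h) \<longleftrightarrow> x \<le> y \<and> (x = 0 \<longrightarrow> y = 0)"
  "init_state (counter_exit h) = 1"
  by (simp_all add: counter_exit_def)

lemma step_rel_counter_exit [simp]:
  "(x, y) \<in> step_rel (counter_exit h) \<longleftrightarrow> x \<noteq> 0 \<and> (y = Suc x \<or> y = 0 \<and> h x)"
  by (auto simp: step_rel_def)

lemma post_counter_exit:
  "post (counter_exit h) x = (if x = 0 then {} else if h x then {Suc x, 0} else {Suc x})"
  by (auto simp: post_def)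

lemma preorder_counter_exit: "preorder_on UNIV (leq (counter_exit h))"
  by (auto simp: preorder_on_def refl_on_def trans_def)

lemma is_olts_counter_exit: "is_olts (counter_exit h)"
  using preorder_counter_exit by (auto simp: is_olts_def)

text \<open>Let \<open>f i\<close> be a least nonzero value. A nonzero value at one of the next two
  positions lies above it; otherwise both of these are \<open>0\<close>, hence comparable. The zero
  sequence is immediate.\<close>

lemma wqo_counter_exit: "wqo_on UNIV (leq (counter_exit h))"
proof -
  have "\<exists>i j. i < j \<and> (f i, f j) \<in> leq (counter_exit h)" for f :: "nat \<Rightarrow> nat"
  proof (cases "\<exists>i. f i \<noteq> 0")
    case True
    then obtain i where i: "f i \<noteq> 0" "\<And>j. f j \<noteq> 0 \<Longrightarrow> f i \<le> f j"
      using ex_has_least_nat[of "\<lambda>i. f i \<noteq> 0" _ f] by metis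
    show ?thesis
    proof (cases "f (Suc i) = 0 \<and> f (Suc (Suc i)) = 0")
      case True
      then have "Suc i < Suc (Suc i) \<and> (f (Suc i), f (Suc (Suc i))) \<in> leq (counter_exit h)"
        by simp
      then show ?thesis by blast
    next
      case False
      then obtain j where "i < j" "f j \<noteq> 0" by (metis lessI less_SucI)
      with i have "i < j \<and> (f i, f j) \<in> leq (counter_exit h)" by simp
      then show ?thesis by blast
    qed
  next
    case False
    then have "(0 :: nat) < 1 \<and> (f 0, f 1) \<in> leq (counter_exit h)" by simp
    then show ?thesis by blast
  qed
  with preorder_counter_exit show ?thesis by (simp add: wqo_on_def)
qed

text \<open>An increment is matched by an increment and, as \<open>h\<close> is monotone, an exit by
  an exit.\<close>

lemma strongly_monotone_counter_exit: "mono h \<Longrightarrow> strongly_monotone (counter_exit h)"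
  unfolding strongly_monotone_def
proof (intro ballI impI)
  fix x y x'
  assume h: "mono h"
    and "(x, y) \<in> leq (counter_exit h) \<and> (x, x') \<in> step_rel (counter_exit h)"
  then have "0 < x" "x \<le> y" and x': "x' = Suc x \<or> x' = 0 \<and> h x" by auto
  moreover from h \<open>x \<le> y\<close> have "h x \<Longrightarrow> h y" by (auto dest: monoD)
  ultimately have "(y, if x' = 0 then 0 else Suc y) \<in> step_rel (counter_exit h) \<and>
      (x', if x' = 0 then 0 else Suc y) \<in> leq (counter_exit h)" by auto
  then show "\<exists>y'. (y, y') \<in> step_rel (counter_exit h) \<and> (x', y') \<in> leq (counter_exit h)"
    by blast
qed

lemma branch_wsts_counter_exit:
  assumes "mono h"
  shows "branch_wsts (counter_exit h)"
  unfolding branch_wsts_def finitely_branching_def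
  using is_olts_counter_exit strongly_monotone_counter_exit[OF assms]
  by (auto simp: post_counter_exit intro: branch_monotone_single_letter branch_wqo_UNIV
      wqo_counter_exit)

text \<open>Only \<open>0\<close> lies above \<open>0\<close>, increments reach every positive
  value, and the last step of a run into \<open>0\<close> is an exit.\<close>

lemma coverable_counter_exit: "coverable (counter_exit h) 0 \<longleftrightarrow> (\<exists>n>0. h n)"
proof -
  have "(1, Suc n) \<in> (step_rel (counter_exit h))\<^sup>*" for n
    by (induction n) (auto elim: rtrancl_into_rtrancl)
  then have "(1, n) \<in> (step_rel (counter_exit h))\<^sup>*" if "0 < n" for n
    using that by (cases n) auto
  then have "(1, 0) \<in> (step_rel (counter_exit h))\<^sup>*" if "0 < n" "h n" for n
    by (rule rtrancl_into_rtrancl[of _ n]) (use that in simp_all)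
  moreover have "\<exists>n>0. h n" if "(1, 0) \<in> (step_rel (counter_exit h))\<^sup>*"
    using that by (cases rule: rtrancl.cases) auto
  ultimately show ?thesis
    by (auto simp: coverable_def down_closure_def post_star_def)
qed

text \<open>The programs of the presentation are built from a program \<open>q\<close> for \<open>h\<close> and from fixed programs,
  so that the code of the presentation is computable from the code of \<open>q\<close>.\<close>

definition exit_presentation :: "prog \<Rightarrow> prog \<Rightarrow> prog \<Rightarrow> prog \<Rightarrow> presentation" where
  "exit_presentation l t s q = \<lparr>
    leq_prog = l,
    letter_progs = [(0, CompP t (PairP (CompP q FstP) idP))],
    post_prog = CompP s (PairP q idP),
    start = 1\<rparr>"

text \<open>The code of \<open>q\<close> is plugged into a fixed term of pairings, where
  \<open>4\<close> and \<open>5\<close> are again program tags; thus the recursion theorem can hand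
  a program the instance built from it.\<close>

lemma computable_exit_instance:
  "\<exists>E. computable E \<and> (\<forall>q. encode_instance (exit_presentation l t s q) 0 = E (prog_code q))"
proof (intro exI conjI allI)
  let ?E = "\<lambda>c. list_encode
    [prog_code l,
     list_encode [prod_encode (0, prod_encode (5, prod_encode (prog_code t, prod_encode (4,
       prod_encode (prod_encode (5, prod_encode (c, prog_code FstP)), prog_code idP)))))],
     prod_encode (5, prod_encode (prog_code s, prod_encode (4, prod_encode (c, prog_code idP)))),
     1, 0]"
  show "computable ?E"
    unfolding list_encode.simps by (intro computable_intros)
  show "encode_instance (exit_presentation l t s q) 0 = ?E (prog_code q)" for q
    by (simp add: encode_instance_def exit_presentation_def)
qed

text \<open>The programs \<open>l\<close>, \<open>t\<close> and \<open>s\<close> are chosen before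
  \<open>q\<close> and \<open>h\<close>, so that the presentation varies with \<open>q\<close>
  alone.\<close>

lemma exit_presentation_presents:
  "\<exists>l t s. \<forall>q h. (\<forall>n. runs q n (if h n then 1 else 0)) \<longrightarrow>
    presents (exit_presentation l t s q) (counter_exit h)"
proof -
  have "computable_set (\<lambda>z. pfst z \<le> psnd z \<and> (pfst z = 0 \<longrightarrow> psnd z = 0))"
    by (intro computable_intros)
  then obtain l where
    l: "\<And>z. runs l z (if pfst z \<le> psnd z \<and> (pfst z = 0 \<longrightarrow> psnd z = 0) then 1 else 0)"
    unfolding computable_set_def computable_def by blast
  \<comment> \<open>The argument \<open>b\<close> receives the output of \<open>q\<close>, so that
    \<open>t\<close> is independent of \<open>h\<close>.\<close>
  let ?T = "\<lambda>(b :: nat) (x :: nat) y. x \<noteq> 0 \<and> (y = Suc x \<or> y = 0 \<and> b = 1)"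
  have "computable_set (\<lambda>z. ?T (pfst z) (pfst (psnd z)) (psnd (psnd z)))"
    by (intro computable_intros)
  then obtain t where
    t: "\<And>z. runs t z (if ?T (pfst z) (pfst (psnd z)) (psnd (psnd z)) then 1 else 0)"
    unfolding computable_set_def computable_def by blast
  let ?S = "\<lambda>(b :: nat) x. if x = 0 then list_encode []
    else if b = 1 then list_encode [Suc x, 0] else list_encode [Suc x]"
  have "computable (\<lambda>z. ?S (pfst z) (psnd z))"
    unfolding list_encode.simps by (intro computable_intros)
  then obtain s where s: "\<And>z. runs s z (?S (pfst z) (psnd z))"
    unfolding computable_def by blast
  have "presents (exit_presentation l t s q) (counter_exit h)"
    if q: "\<And>n. runs q n (if h n then 1 else 0)" for q h
  proof -
    have "z \<in> prod_encode ` leq (counter_exit h) \<longleftrightarrow>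
        pfst z \<le> psnd z \<and> (pfst z = 0 \<longrightarrow> psnd z = 0)" for z
      by (cases z rule: prod_encode_exhaust) (auto simp: inj_image_mem_iff inj_prod_encode)
    with l have 1: "decides l (prod_encode ` leq (counter_exit h))"
      by (simp add: decides_def)
    have "runs (CompP t (PairP (CompP q FstP) idP)) z
        (if ?T (if h (pfst z) then 1 else 0) (pfst z) (psnd z) then 1 else 0)" for z
      using runs_Comp[OF runs_Pair[OF runs_Comp[OF runs_fst q] runs_id] t, of z]
      by (simp only: prod_encode_inverse fst_conv snd_conv)
    moreover have "z \<in> {prod_encode (x, y) |x y. (x, 0, y) \<in> transitions (counter_exit h)} \<longleftrightarrow>
        ?T (if h (pfst z) then 1 else 0) (pfst z) (psnd z)" for z
      by (cases z rule: prod_encode_exhaust) auto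
    ultimately have 2: "decides (CompP t (PairP (CompP q FstP) idP))
        {prod_encode (x, y) |x y. (x, 0, y) \<in> transitions (counter_exit h)}"
      unfolding decides_def by presburger
    have "runs (CompP s (PairP q idP)) x (?S (if h x then 1 else 0) x)" for x
      using runs_Comp[OF runs_Pair[OF q runs_id] s, of x]
      by (simp only: prod_encode_inverse fst_conv snd_conv)
    then have run: "runs (CompP s (PairP q idP)) x
        (list_encode (if x = 0 then [] else if h x then [Suc x, 0] else [Suc x]))" for x
      by (rule back_subst[of "runs _ x"]) auto
    have 3: "\<exists>ys. set ys = post (counter_exit h) x \<and>
        runs (CompP s (PairP q idP)) x (list_encode ys)" for x
      by (rule exI, rule conjI[OF _ run]) (simp add: post_counter_exit)
    from 1 2 3 show ?thesis
      by (simp add: presents_def exit_presentation_def del: counter_exit_simps(3))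
  qed
  then show ?thesis by blast
qed

section \<open>Undecidability by diagonalisation\<close>

theorem theorem5p2:
  "\<not> coverability_decidable {S. branch_effective S \<and> branch_wsts S} \<and>
   \<not> coverability_decidable {S. branch_effective S \<and> branch_wsts S \<and>
       strongly_monotone S \<and> wqo_on (states S) (leq S)}"
proof -
  let ?D = "{S. branch_effective S \<and> branch_wsts S \<and>
       strongly_monotone S \<and> wqo_on (states S) (leq S)}"
  have "\<not> coverability_decidable ?D"
  proof
    assume "coverability_decidable ?D"
    then obtain d where d: "\<And>S P y. S \<in> ?D \<Longrightarrow> presents P S \<Longrightarrow> y \<in> states S \<Longrightarrow>
        runs d (encode_instance P y) (if coverable S y then 1 else 0)"
      unfolding coverability_decidable_def by blast
    obtain l t s where lts: "\<And>q h. (\<And>n. runs q n (if h n then 1 else 0)) \<Longrightarrow>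
        presents (exit_presentation l t s q) (counter_exit h)"
      using exit_presentation_presents by metis
    obtain E where E: "computable E"
      "\<And>q. encode_instance (exit_presentation l t s q) 0 = E (prog_code q)"
      using computable_exit_instance by metis
    have "computable (\<lambda>z. eval_upto d (psnd z) (E (pfst z)))"
      by (rule computable_comp2[of "\<lambda>n x. eval_upto d n x"])
        (intro computable_eval_upto computable_comp[OF E(1)] computable_intros)+
    \<comment> \<open>The value \<open>1\<close> is \<open>Suc 0\<close>: within the bound
      \<open>d\<close> has answered \<open>0\<close>, that is, not coverable.\<close>
    then have "computable (\<lambda>z. if eval_upto d (psnd z) (E (pfst z)) = 1 then 1 else 0)"
      by (intro computable_intros)
    from recursion_theorem[OF this] obtain q where
      q: "\<And>n. runs q n (if eval_upto d n (E (prog_code q)) = 1 then 1 else 0)"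
      by auto
    define h where "h n \<longleftrightarrow> eval_upto d n (E (prog_code q)) = 1" for n
    have "mono h"
      unfolding mono_def h_def le_bool_def using eval_upto_mono[of d _ _ 0] by auto
    have pr: "presents (exit_presentation l t s q) (counter_exit h)"
      using q by (intro lts) (simp add: h_def)
    then have "counter_exit h \<in> ?D"
      using branch_wsts_counter_exit[OF \<open>mono h\<close>] strongly_monotone_counter_exit[OF \<open>mono h\<close>]
        wqo_counter_exit by (auto simp: branch_effective_def)
    from d[OF this pr, of 0] E(2)
    have run: "runs d (E (prog_code q)) (if coverable (counter_exit h) 0 then 1 else 0)" by simp
    show False
    proof (cases "coverable (counter_exit h) 0")
      case True
      then obtain n where "h n" by (auto simp: coverable_counter_exit)
      \<comment> \<open>An open exit means that \<open>d\<close> did answer \<open>0\<close>,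
        against its correct answer \<open>1\<close>.\<close>
      then have "runs d (E (prog_code q)) 0" by (auto simp: h_def intro: eval_upto_sound)
      with run True show False by (auto dest: runs_functional)
    next
      case False
      \<comment> \<open>Here \<open>d\<close> must halt with \<open>0\<close>; a large enough bound
        detects this and opens the exit.\<close>
      with run obtain n where "h n"
        using eval_upto_complete by (fastforce simp: h_def)
      \<comment> \<open>The bound found may be \<open>0\<close>, which is the dead state; its
        successor is a positive value with an open exit.\<close>
      then have "h (Suc n)" using monoD[OF \<open>mono h\<close>, of n "Suc n"] by auto
      with False show False by (auto simp: coverable_counter_exit)
    qed
  qed
  \<comment> \<open>An algorithm for the larger class would also serve the smaller one.\<close>
  moreover have "?D \<subseteq> {S. branch_effective S \<and> branch_wsts S}" by blast
  ultimately show ?thesis using coverability_decidable_subset by blast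
qed

end
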